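(* Let $(\mathcal{X},d)$ be a complete metric space and $f\colon\mathcal{X}\to\mathbb{R}\cup\{+\infty\}$ a closed function. Consider a sequence of points $x_k\in\mathcal{X}$ with $f(x_k)$ finite and closed functions $f_{x_k}\colon\mathcal{X}\to\mathbb{R}\cup\{+\infty\}$ satisfying $d(x_{k+1},x_k)\to0$ and $f_{x_k}(x_{k+1})\leq\inf f_{x_k}+\epsilon_k$ for all $k$, for some sequence $\epsilon_k\to0$. Suppose moreover that $$|f_{x_k}(y)-f(y)|\leq\omega(d(y,x_k))\quad\text{for all indices } k\text{ and all points } y\in\mathcal{X},$$ where $\omega$ is a proper growth function. If $(x^*,f(x^* ))\in\mathcal{X}\times\mathbb{R}$ is a limit point (i.e. the limit of a subsequence) of the sequence $(x_k,f(x_k))$, then $x^*$ is stationary for $f$.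
   Context: A function on a metric space is called closed if it is lower-semicontinuous. A growth function is a differentiable function $\omega\colon[0,\infty)\to[0,\infty)$ (one-sided derivative at $0$) with $\omega(0)=\omega'(0)=0$ and $\omega'>0$ on $(0,\infty)$; it is proper if in addition $\lim_{t\to0^+}\omega'(t)=\lim_{t\to 0^+}\omega(t)/\omega'(t)=0$. The slope of $f$ at a point $\bar x$ with $f(\bar x)$ finite is $|\nabla f|(\bar x):=\limsup_{x\to\bar x,\,x\ne\bar x}\frac{(f(\bar x)-f(x))^+}{d(\bar x,x)}$, where $r^+=\max\{0,r\}$ (it is $0$ if $\bar x$ is isolated). The limiting slope is $\overline{|\nabla f|}(\bar x):=\liminf_{x\to\bar x,\,f(x)\to f(\bar x)}|\nabla f|(x)$, where $x=\bar x$ is allowed in the liminf. A point $\bar x$ is stationary for $f$ if $\overline{|\nabla f|}(\bar x)=0$. The inequality $|f_{x_k}(y)-f(y)|\le\omega(d(y,x_k))$ is understood to mean that $f_{x_k}(y)$ and $f(y)$ are either both $+\infty$ or both finite and satisfying the inequality. *)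

theory Defs
  imports "HOL-Analysis.Analysis"
begin

text \<open>Functions with values in the reals extended by plus infinity are rendered as
  \<^typ>\<open>ereal\<close>-valued functions that never take the value minus infinity.\<close>

definition never_minf :: "('a \<Rightarrow> ereal) \<Rightarrow> bool" where
  "never_minf f \<longleftrightarrow> (\<forall>x. f x \<noteq> -\<infinity>)"

text \<open>Closed means lower semicontinuous. At an isolated point the filter is trivial, the
  \<^const>\<open>Liminf\<close> is plus infinity, and the condition is void, as it should be.\<close>

definition closed_fun :: "('a::metric_space \<Rightarrow> ereal) \<Rightarrow> bool" where
  "closed_fun f \<longleftrightarrow> (\<forall>x. f x \<le> Liminf (at x) f)"

text \<open>Only the restriction of \<open>\<omega>\<close> to the nonnegative reals matters: the derivative at 0 is
  one-sided, and at \<open>t > 0\<close> differentiability within the half-line is ordinary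
  differentiability.\<close>

definition growth_function :: "(real \<Rightarrow> real) \<Rightarrow> bool" where
  "growth_function \<omega> \<longleftrightarrow>
     (\<forall>t\<ge>0. 0 \<le> \<omega> t) \<and>
     \<omega> differentiable_on {0..} \<and>
     \<omega> 0 = 0 \<and>
     (\<omega> has_real_derivative 0) (at 0 within {0..}) \<and>
     (\<forall>t>0. 0 < deriv \<omega> t)"

definition proper_growth_function :: "(real \<Rightarrow> real) \<Rightarrow> bool" where
  "proper_growth_function \<omega> \<longleftrightarrow>
     growth_function \<omega> \<and>
     (deriv \<omega> \<longlongrightarrow> 0) (at_right 0) \<and>
     ((\<lambda>t. \<omega> t / deriv \<omega> t) \<longlongrightarrow> 0) (at_right 0)"

text \<open>The slope is meant for points where \<open>f\<close> is finite; its value elsewhere is irrelevant.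
  The case distinction is needed since \<^const>\<open>Limsup\<close> along the trivial filter is minus
  infinity.\<close>

definition slope :: "('a::metric_space \<Rightarrow> ereal) \<Rightarrow> 'a \<Rightarrow> ereal" where
  "slope f xbar =
     (if at xbar = bot then 0
      else Limsup (at xbar) (\<lambda>x. max 0 (f xbar - f x) / ereal (dist xbar x)))"

text \<open>The filter expresses that \<open>x\<close> tends to \<open>xbar\<close>, with \<open>x = xbar\<close> allowed, and \<open>f x\<close> tends
  to \<open>f xbar\<close>. If \<open>f xbar\<close> is finite, then \<open>f x\<close> is eventually finite along it.\<close>

definition limiting_slope :: "('a::metric_space \<Rightarrow> ereal) \<Rightarrow> 'a \<Rightarrow> ereal" where
  "limiting_slope f xbar =
     Liminf (inf (nhds xbar) (filtercomap f (nhds (f xbar)))) (slope f)"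

definition stationary :: "('a::metric_space \<Rightarrow> ereal) \<Rightarrow> 'a \<Rightarrow> bool" where
  "stationary f xbar \<longleftrightarrow> \<bar>f xbar\<bar> \<noteq> \<infinity> \<and> limiting_slope f xbar = 0"

text \<open>The inequality \<open>\<bar>a - b\<bar> \<le> r\<close> for extended values: both plus infinity, or both finite
  and satisfying the inequality.\<close>

definition ext_close :: "ereal \<Rightarrow> ereal \<Rightarrow> real \<Rightarrow> bool" where
  "ext_close a b r \<longleftrightarrow>
     (a = \<infinity> \<and> b = \<infinity>) \<or>
     (\<bar>a\<bar> \<noteq> \<infinity> \<and> \<bar>b\<bar> \<noteq> \<infinity> \<and> \<bar>a - b\<bar> \<le> ereal r)"

end

theory Submission
  imports Defs
begin

text \<open>The function \<open>y \<mapsto> f y + \<omega> (dist y x\<^sub>k)\<close> majorizes the model at \<open>x\<^sub>k\<close>, and at \<open>x\<^sub>k\<^sub>+\<^sub>1\<close> it exceeds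
  the infimum of the model by at most \<open>\<eta>\<^sub>k = \<epsilon>\<^sub>k + 2 \<omega> (dist x\<^sub>k\<^sub>+\<^sub>1 x\<^sub>k)\<close>, which tends to 0.
  For fixed \<open>e > 0\<close>, Ekeland's principle with constant \<open>e/2\<close> gives a point \<open>z\<^sub>k\<close> within
  \<open>2 \<eta>\<^sub>k / e\<close> of \<open>x\<^sub>k\<^sub>+\<^sub>1\<close> at which this majorant has slope at most \<open>e/2\<close>. Near 0 the derivative
  of \<open>\<omega>\<close> is below \<open>e/2\<close>, so the slope of \<open>f\<close> at \<open>z\<^sub>k\<close> is at most \<open>e\<close>. Along the subsequence
  \<open>z\<^sub>k\<close> tends to \<open>x\<^sup>*\<close>, and \<open>f z\<^sub>k \<le> f x\<^sub>k + \<eta>\<^sub>k\<close> with lower semicontinuity gives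
  convergence of the values.\<close>

section \<open>Lower semicontinuity through neighbourhoods and sequences\<close>

lemma closed_funI:
  assumes "\<And>x C. C < h x \<Longrightarrow> \<forall>\<^sub>F y in nhds x. C < h y"
  shows "closed_fun h"
  unfolding closed_fun_def le_Liminf_iff
  using assms unfolding eventually_at_filter by (blast intro: eventually_mono)

text \<open>Unlike \<open>at x\<close>, the filter \<open>nhds x\<close> composes with sequences
  that may hit their limit; at \<open>x\<close> itself the bound is the hypothesis
  \<open>C < h x\<close>.\<close>

lemma closed_funD:
  assumes "closed_fun h" "C < h x"
  shows "\<forall>\<^sub>F y in nhds x. C < h y"
proof -
  have "\<forall>\<^sub>F y in at x. C < h y"
    using assms unfolding closed_fun_def le_Liminf_iff by blast
  then show ?thesis
    using assms(2) unfolding eventually_at_filter by (auto elim!: eventually_mono)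
qed

lemma closed_fun_le_liminf:
  assumes "closed_fun h" "s \<longlonglongrightarrow> v"
  shows "h v \<le> liminf (\<lambda>n. h (s n))"
  unfolding le_Liminf_iff
  using eventually_compose_filterlim[OF closed_funD[OF assms(1)] assms(2)] by blast

lemma closed_fun_add_continuous:
  assumes cl: "closed_fun f" and w: "continuous_on UNIV w"
  shows "closed_fun (\<lambda>y. f y + ereal (w y))"
proof (rule closed_funI)
  fix x C assume "C < f x + ereal (w x)"
  then have "C - ereal (w x) < f x"
    by (cases C; cases "f x") auto
  \<comment> \<open>\<open>D\<close> splits the inequality into two that persist near
    \<open>x\<close>: \<open>D < f y\<close> by semicontinuity and \<open>C < D + w y\<close> by
    continuity of \<open>w\<close>.\<close>
  then obtain D where D: "C - ereal (w x) < ereal D" "ereal D < f x"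
    using ereal_dense2 by blast
  have "C < ereal (D + w x)" using D(1) by (cases C) auto
  moreover have "((\<lambda>y. ereal (D + w y)) \<longlongrightarrow> ereal (D + w x)) (nhds x)"
    using w by (auto intro!: tendsto_intros
        simp: continuous_on_def isCont_def tendsto_at_iff_tendsto_nhds)
  ultimately have "\<forall>\<^sub>F y in nhds x. C < ereal (D + w y)"
    by (rule order_tendstoD(1)[rotated])
  with closed_funD[OF cl D(2)] show "\<forall>\<^sub>F y in nhds x. C < f y + ereal (w y)"
  proof eventually_elim
    case (elim y) then show ?case by (cases C; cases "f y") auto
  qed
qed

text \<open>Semicontinuity controls the values from below, the majorant \<open>u\<close> from
  above.\<close>

lemma closed_fun_tendsto_of_upper_bound:
  assumes "closed_fun h" "s \<longlonglongrightarrow> v" and "\<forall>\<^sub>F n in sequentially. h (s n) \<le> u n" and "u \<longlonglongrightarrow> h v"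
  shows "(\<lambda>n. h (s n)) \<longlonglongrightarrow> h v"
proof (rule order_tendstoI)
  fix a assume "a < h v"
  from eventually_compose_filterlim[OF closed_funD[OF assms(1) this] assms(2)]
  show "\<forall>\<^sub>F n in sequentially. a < h (s n)" .
next
  fix a assume "h v < a"
  from order_tendstoD(2)[OF assms(4) this] assms(3)
  show "\<forall>\<^sub>F n in sequentially. h (s n) < a"
    by eventually_elim order
qed

section \<open>Ekeland's variational principle\<close>

text \<open>Greedy descent: each new point minimizes \<open>h\<close>, up to \<open>(1/2)^n\<close>,
  over the points below its predecessor in Ekeland's order. The decrease of \<open>h\<close> pays
  for the distances, so the points converge; a point violating the second claim at the limit would
  lie below all of them and have too small a value.\<close>

lemma Ekeland_variational_principle:
  fixes h :: "'a::complete_space \<Rightarrow> ereal"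
  assumes cl: "closed_fun h" and bdd: "\<And>y. ereal m \<le> h y" and fin: "h p \<noteq> \<infinity>" and lam: "0 < \<kappa>"
  obtains z where "h z + ereal (\<kappa> * dist z p) \<le> h p"
    and "\<And>y. h z \<le> h y + ereal (\<kappa> * dist z y)"
proof -
  \<comment> \<open>The lower section of \<open>u\<close> in Ekeland's order.\<close>
  define S where "S u = {y. h y + ereal (\<kappa> * dist u y) \<le> h u}" for u
  have step: "\<exists>y. y \<in> S u \<and> (\<forall>w\<in>S u. h y \<le> h w + ereal ((1/2)^n))" if "h u \<noteq> \<infinity>" for u n
  proof -
    have "u \<in> S u" by (simp add: S_def flip: zero_ereal_def)
    then have "(INF w\<in>S u. h w) \<le> h u" by (rule INF_lower)
    moreover have "ereal m \<le> (INF w\<in>S u. h w)" using bdd by (intro INF_greatest)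
    ultimately have "\<bar>INF w\<in>S u. h w\<bar> \<noteq> \<infinity>" using that by auto
    then have "(INF w\<in>S u. h w) < (INF w\<in>S u. h w) + ereal ((1/2)^n)"
      by (cases "INF w\<in>S u. h w") auto
    then obtain y where y: "y \<in> S u" "h y < (INF w\<in>S u. h w) + ereal ((1/2)^n)"
      unfolding INF_less_iff by blast
    have "h y \<le> h w + ereal ((1/2)^n)" if "w \<in> S u" for w
      using y(2) add_right_mono[OF INF_lower[OF that, of h]] by (meson less_le_trans less_imp_le)
    with y(1) show ?thesis by blast
  qed
  have fin_S: "h y \<noteq> \<infinity>" if "y \<in> S u" "h u \<noteq> \<infinity>" for u y
    using that by (auto simp: S_def)
  \<comment> \<open>Finiteness is carried along the recursion because \<open>step\<close> needs it;
    the conjunct with \<open>n = 0\<close> pins the start at \<open>p\<close>.\<close>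
  have "\<exists>s. \<forall>n. (h (s n) \<noteq> \<infinity> \<and> (n = 0 \<longrightarrow> s n = p)) \<and>
      (s (Suc n) \<in> S (s n) \<and> (\<forall>w\<in>S (s n). h (s (Suc n)) \<le> h w + ereal ((1/2)^n)))"
  proof (rule dependent_nat_choice)
    show "\<exists>u. h u \<noteq> \<infinity> \<and> ((0::nat) = 0 \<longrightarrow> u = p)" using fin by blast
    show "\<exists>y. (h y \<noteq> \<infinity> \<and> (Suc n = 0 \<longrightarrow> y = p)) \<and>
        y \<in> S u \<and> (\<forall>w\<in>S u. h y \<le> h w + ereal ((1/2)^n))"
      if "h u \<noteq> \<infinity> \<and> (n = 0 \<longrightarrow> u = p)" for u n
      using step[of u n] fin_S that by (metis nat.distinct(1))
  qed
  then obtain s where s_fin: "\<And>n. h (s n) \<noteq> \<infinity>" and s0: "s 0 = p"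
    and s_S: "\<And>n. s (Suc n) \<in> S (s n)"
    and s_min: "\<And>n w. w \<in> S (s n) \<Longrightarrow> h (s (Suc n)) \<le> h w + ereal ((1/2)^n)"
    by blast
  define a where "a n = real_of_ereal (h (s n))" for n
  have h_s: "h (s n) = ereal (a n)" for n
    using s_fin[of n] bdd[of "s n"] by (cases "h (s n)") (auto simp: a_def)
  have a_step: "a (Suc n) + \<kappa> * dist (s n) (s (Suc n)) \<le> a n" for n
    using s_S[of n] by (auto simp: S_def h_s)
  \<comment> \<open>Telescoping with the triangle inequality. Once \<open>a\<close> converges, this
    makes \<open>s\<close> a Cauchy sequence.\<close>
  have a_dec: "a (n + k) + \<kappa> * dist (s n) (s (n + k)) \<le> a n" for n k
  proof (induction k)
    case (Suc k)
    have "\<kappa> * dist (s n) (s (n + Suc k))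
        \<le> \<kappa> * (dist (s n) (s (n + k)) + dist (s (n + k)) (s (n + Suc k)))"
      using lam dist_triangle by (intro mult_left_mono) auto
    then show ?case using Suc a_step[of "n + k"] by (simp add: algebra_simps)
  qed simp
  have a_ge: "m \<le> a n" for n using bdd[of "s n"] by (simp add: h_s)
  have "decseq a"
    by (rule decseq_SucI) (use a_step lam in \<open>smt (verit) zero_le_dist mult_nonneg_nonneg\<close>)
  then obtain A where A: "a \<longlonglongrightarrow> A"
    using decseq_convergent[of a m] a_ge by metis
  have "Cauchy s"
  proof (rule metric_CauchyI)
    fix e :: real assume "0 < e"
    from metric_CauchyD[OF LIMSEQ_imp_Cauchy[OF A], of "\<kappa> * (e / 2)"] lam \<open>0 < e\<close>
    obtain N where N: "\<And>i j. N \<le> i \<Longrightarrow> N \<le> j \<Longrightarrow> dist (a i) (a j) < \<kappa> * (e / 2)" by auto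
    have "dist (s N) (s i) < e / 2" if i: "N \<le> i" for i
    proof -
      have "\<kappa> * dist (s N) (s i) \<le> a N - a i" using a_dec[of N "i - N"] i by simp
      also have "\<dots> < \<kappa> * (e / 2)"
        using N[of N i] i abs_ge_self[of "a N - a i"] unfolding dist_real_def by linarith
      finally show ?thesis using lam by simp
    qed
    then show "\<exists>M. \<forall>i\<ge>M. \<forall>j\<ge>M. dist (s i) (s j) < e"
      using dist_triangle_half_r by blast
  qed
  then obtain z where z: "s \<longlonglongrightarrow> z"
    using Cauchy_convergent convergent_def by blast
  have "h z \<le> liminf (\<lambda>n. h (s n))" using closed_fun_le_liminf[OF cl z] .
  also have "\<dots> = ereal A"
    using A by (intro lim_imp_Liminf) (auto simp: h_s)
  finally have hz: "h z \<le> ereal A" .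
  \<comment> \<open>The limit of \<open>a_dec\<close> as \<open>k\<close> tends to infinity, with
    \<open>A\<close> then replaced by the smaller \<open>h z\<close>. The case \<open>n = 0\<close>
    is the first claim.\<close>
  have z_S: "h z + ereal (\<kappa> * dist (s n) z) \<le> h (s n)" for n
  proof -
    have "A + \<kappa> * dist (s n) z \<le> a n"
    proof (rule LIMSEQ_le_const2)
      show "(\<lambda>k. a (n + k) + \<kappa> * dist (s n) (s (n + k))) \<longlonglongrightarrow> A + \<kappa> * dist (s n) z"
        using LIMSEQ_ignore_initial_segment[OF A, of n] LIMSEQ_ignore_initial_segment[OF z, of n]
        by (intro tendsto_intros) (simp_all add: add.commute)
    qed (use a_dec in blast)
    then have "ereal A + ereal (\<kappa> * dist (s n) z) \<le> h (s n)" by (simp add: h_s)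
    with hz show ?thesis by (meson add_right_mono order_trans)
  qed
  have "h z \<le> h y + ereal (\<kappa> * dist z y)" for y
  proof (rule ccontr)
    assume "\<not> ?thesis"
    then have less: "h y + ereal (\<kappa> * dist z y) < h z" by simp
    \<comment> \<open>A point that improves on \<open>z\<close> improves on every
      \<open>s n\<close>. Then \<open>s_min\<close> bounds \<open>A\<close> by \<open>h y\<close>,
      while \<open>less\<close> and \<open>hz\<close> give \<open>h y < A\<close>.\<close>
    have y_S: "y \<in> S (s n)" for n
    proof -
      have "\<kappa> * dist (s n) y \<le> \<kappa> * dist (s n) z + \<kappa> * dist z y"
        using lam dist_triangle by (simp flip: distrib_left)
      then show ?thesis using less z_S[of n]
        by (cases "h y"; cases "h z") (auto simp: S_def h_s)
    qed
    obtain b where b: "h y = ereal b"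
      using y_S[of 0] bdd[of y] by (cases "h y") (auto simp: S_def h_s)
    have "a (Suc n) \<le> b + (1/2)^n" for n
      using s_min[OF y_S] by (simp add: h_s b)
    then have "A \<le> b + 0"
      by (intro LIMSEQ_le[OF LIMSEQ_Suc[OF A], of "\<lambda>n. b + (1/2)^n"] tendsto_intros) auto
    moreover have "0 \<le> \<kappa> * dist z y" using lam by simp
    ultimately show False using less hz b by (cases "h z") auto
  qed
  moreover have "h z + ereal (\<kappa> * dist z p) \<le> h p"
    using z_S[of 0] by (simp add: s0 dist_commute)
  ultimately show ?thesis using that by blast
qed

section \<open>Slopes and growth functions\<close>

lemma slope_nonneg: "0 \<le> slope f z"
  unfolding slope_def
  by (auto intro!: le_Limsup always_eventually zero_le_divide_ereal)

text \<open>A neighbour with \<open>f y\<close> infinite has quotient 0, and an isolated point has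
  slope 0; both cases rely on \<open>c\<close> being nonnegative.\<close>

lemma slope_le:
  assumes nm: "never_minf f" and fin: "f z \<noteq> \<infinity>" and c: "0 \<le> c"
    and le: "\<forall>\<^sub>F y in at z. f z \<le> f y + ereal (c * dist z y)"
  shows "slope f z \<le> ereal c"
proof (cases "at z = bot")
  case False
  have "\<forall>\<^sub>F y in at z. max 0 (f z - f y) / ereal (dist z y) \<le> ereal c"
    using le eventually_neq_at_within[of z z UNIV]
  proof eventually_elim
    case (elim y)
    moreover obtain b where "f z = ereal b"
      using fin nm by (cases "f z") (auto simp: never_minf_def)
    ultimately show ?case
      using c nm by (cases "f y") (auto simp: never_minf_def max_def pos_divide_le_eq)
  qed
  then show ?thesis using False by (simp add: slope_def Limsup_bounded)
qed (simp add: slope_def c)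

text \<open>Mean value theorem on an interval where \<open>deriv \<omega>\<close> lies strictly
  between 0 and \<open>e\<close>; the endpoint 0 enters only through continuity. For
  \<open>s < t\<close> the left side is negative by monotonicity.\<close>

lemma proper_growth_function_local_Lipschitz:
  assumes \<omega>: "proper_growth_function \<omega>" and e: "0 < e"
  obtains \<delta> where "0 < \<delta>"
    and "\<And>s t. 0 \<le> s \<Longrightarrow> s < \<delta> \<Longrightarrow> 0 \<le> t \<Longrightarrow> t < \<delta> \<Longrightarrow> \<omega> s - \<omega> t \<le> e * \<bar>s - t\<bar>"
proof -
  have diff: "\<omega> differentiable_on {0..}" and pos: "\<And>t. 0 < t \<Longrightarrow> 0 < deriv \<omega> t"
    and lim: "(deriv \<omega> \<longlongrightarrow> 0) (at_right 0)"
    using \<omega> by (auto simp: proper_growth_function_def growth_function_def)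
  from order_tendstoD(2)[OF lim e] obtain \<delta> where \<delta>: "0 < \<delta>"
    and small: "\<And>t. 0 < t \<Longrightarrow> t < \<delta> \<Longrightarrow> deriv \<omega> t < e"
    unfolding eventually_at_right_field by auto
  have der: "(\<omega> has_real_derivative deriv \<omega> t) (at t)" if "0 < t" for t
  proof -
    have "\<omega> differentiable at t within {0..}" using diff that by (auto simp: differentiable_on_def)
    moreover have "at t within {0..} = at t" using that by (intro at_within_interior) auto
    ultimately show ?thesis by (simp add: DERIV_deriv_iff_real_differentiable)
  qed
  have mvt: "\<exists>d. 0 < d \<and> d < e \<and> \<omega> t - \<omega> s = d * (t - s)"
    if st: "0 \<le> s" "s < t" "t < \<delta>" for s t
  proof -
    have "continuous_on {s..t} \<omega>"
      using differentiable_imp_continuous_on[OF diff] st by (auto intro: continuous_on_subset)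
    then obtain \<xi> where \<xi>: "s < \<xi>" "\<xi> < t" "\<omega> t - \<omega> s = deriv \<omega> \<xi> * (t - s)"
      using mvt[of s t \<omega> "\<lambda>u. (*) (deriv \<omega> u)"] der st
      by (metis has_field_derivative_def order_le_less_trans)
    then show ?thesis using pos[of \<xi>] small[of \<xi>] st by auto
  qed
  have "\<omega> s - \<omega> t \<le> e * \<bar>s - t\<bar>" if st: "0 \<le> s" "s < \<delta>" "0 \<le> t" "t < \<delta>" for s t
  proof (cases s t rule: linorder_cases)
    case less
    from mvt[OF st(1) this st(4)] obtain d where "0 < d" "\<omega> t - \<omega> s = d * (t - s)" by auto
    moreover from this less have "0 \<le> d * (t - s)" by simp
    ultimately show ?thesis using e by (smt (verit) mult_nonneg_nonneg abs_ge_zero)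
  next
    case greater
    from mvt[OF st(3) this st(2)] obtain d where "d < e" "\<omega> s - \<omega> t = d * (s - t)" by auto
    with greater show ?thesis by (simp add: mult_right_mono)
  qed simp
  with \<delta> show ?thesis using that by blast
qed

section \<open>Ekeland points near the almost minimizers of the models\<close>

lemma near_minimizer_of_model:
  fixes f :: "'a::complete_space \<Rightarrow> ereal"
  assumes nm: "never_minf f" and cl: "closed_fun f" and fx: "f x \<noteq> \<infinity>"
    and \<omega>_nonneg: "\<And>t. 0 \<le> t \<Longrightarrow> 0 \<le> \<omega> t" and \<omega>_cont: "continuous_on {0..} \<omega>" and \<omega>0: "\<omega> 0 = 0"
    and close: "\<And>y. ext_close (g y) (f y) (\<omega> (dist y x))"
    and min: "\<And>y. g p \<le> g y + ereal \<epsilon>"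
    and lam: "0 < \<kappa>" and \<eta>: "\<eta> = \<epsilon> + 2 * \<omega> (dist p x)"
  obtains z where "\<kappa> * dist z p \<le> \<eta>" and "f z \<le> f x + ereal \<eta>"
    and "\<And>y. f z + ereal (\<omega> (dist z x)) \<le> f y + ereal (\<omega> (dist y x) + \<kappa> * dist z y)"
proof -
  define h where "h y = f y + ereal (\<omega> (dist y x))" for y
  have g_le: "g y \<le> h y" for y
    using close[of y] unfolding ext_close_def h_def by (cases "g y"; cases "f y") auto
  \<comment> \<open>The model is exact at its centre, so near-minimality compares \<open>g p\<close>
    with \<open>f x\<close>. This yields the finiteness of \<open>g p\<close> and later the bound on
    \<open>f z\<close>.\<close>
  have gx: "g x = f x"
    using close[of x] \<omega>0 unfolding ext_close_def by (cases "g x"; cases "f x") auto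
  obtain b where b: "f x = ereal b"
    using fx nm by (cases "f x") (auto simp: never_minf_def)
  have "g p \<noteq> \<infinity>" using min[of x] by (auto simp: gx b)
  then obtain c q where cq: "g p = ereal c" "f p = ereal q" "\<bar>c - q\<bar> \<le> \<omega> (dist p x)"
    using close[of p] unfolding ext_close_def by (cases "g p"; cases "f p") auto
  \<comment> \<open>Near-minimality of \<open>p\<close> for \<open>g\<close> passes to the majorant
    \<open>h\<close>. It gives the lower bound for Ekeland's principle and, taken at
    \<open>z\<close>, the bound on \<open>dist z p\<close>.\<close>
  have c_le: "ereal (c - \<epsilon>) \<le> h y" for y
  proof -
    have "ereal (c - \<epsilon>) \<le> g y" using min[of y] cq by (cases "g y") auto
    then show ?thesis using g_le order_trans by blast
  qed
  \<comment> \<open>One \<open>\<omega> (dist p x)\<close> is the cost of replacing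
    \<open>g p\<close> by \<open>f p\<close>, the other is the summand in \<open>h\<close>.\<close>
  have hp: "h p \<le> ereal (c + 2 * \<omega> (dist p x))" using cq by (simp add: h_def)
  have "continuous_on UNIV (\<lambda>y. \<omega> (dist y x))"
    by (rule continuous_on_compose2[OF \<omega>_cont]) (auto intro: continuous_intros)
  then have "closed_fun h" unfolding h_def by (intro closed_fun_add_continuous cl)
  moreover have "h p \<noteq> \<infinity>" using hp by auto
  ultimately obtain z where z: "h z + ereal (\<kappa> * dist z p) \<le> h p"
      "\<And>y. h z \<le> h y + ereal (\<kappa> * dist z y)"
    using Ekeland_variational_principle[where h = h, OF _ c_le _ lam] by metis
  have hz: "h z + ereal (\<kappa> * dist z p) \<le> ereal (c + 2 * \<omega> (dist p x))"
    using z(1) hp by order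
  obtain u where u: "f z = ereal u"
    using hz nm by (cases "f z") (auto simp: never_minf_def h_def)
  have hz_real: "u + \<omega> (dist z x) + \<kappa> * dist z p \<le> c + 2 * \<omega> (dist p x)"
    using hz by (simp add: h_def u)
  show ?thesis
  proof
    show "\<kappa> * dist z p \<le> \<eta>" using c_le[of z] hz_real by (simp add: h_def u \<eta>)
    have "0 \<le> \<omega> (dist z x)" "0 \<le> \<kappa> * dist z p" using \<omega>_nonneg lam by auto
    then show "f z \<le> f x + ereal \<eta>"
      using hz_real min[of x] cq(1) by (simp add: u b gx \<eta>)
    show "f z + ereal (\<omega> (dist z x)) \<le> f y + ereal (\<omega> (dist y x) + \<kappa> * dist z y)" for y
      using z(2)[of y] unfolding h_def by (cases "f y") (auto simp: add.assoc)
  qed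
qed

text \<open>A sequence converging together with its values refines the filter of the limiting slope,
  and a finer filter has a larger \<open>Liminf\<close>.\<close>

lemma limiting_slope_le:
  assumes "z \<longlonglongrightarrow> xbar" "(\<lambda>n. f (z n)) \<longlonglongrightarrow> f xbar" "\<forall>\<^sub>F n in sequentially. slope f (z n) \<le> c"
  shows "limiting_slope f xbar \<le> c"
proof -
  let ?F = "inf (nhds xbar) (filtercomap f (nhds (f xbar)))"
  have "filterlim z ?F sequentially"
    using assms(1,2) by (simp add: filterlim_inf filterlim_filtercomap_iff o_def)
  then have "filtermap z sequentially \<le> ?F" by (simp add: filterlim_def)
  have "limiting_slope f xbar \<le> Liminf (filtermap z sequentially) (slope f)"
    unfolding limiting_slope_def Liminf_def
    using \<open>filtermap z sequentially \<le> ?F\<close> by (intro SUP_subset_mono) (auto simp: le_filter_def)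
  also have "\<dots> \<le> c"
    using assms(3) by (intro Liminf_le) (simp_all add: filtermap_bot_iff eventually_filtermap)
  finally show ?thesis .
qed

section \<open>Stationarity of the limit point\<close>

theorem corollary5p3:
  fixes f :: "'a::complete_space \<Rightarrow> ereal"
    and x :: "nat \<Rightarrow> 'a"
    and fm :: "nat \<Rightarrow> 'a \<Rightarrow> ereal"
    and \<epsilon> :: "nat \<Rightarrow> real"
    and \<omega> :: "real \<Rightarrow> real"
    and xstar :: 'a
  assumes "never_minf f" and "closed_fun f"
    and "\<And>k. \<bar>f (x k)\<bar> \<noteq> \<infinity>"
    and "\<And>k. never_minf (fm k)" and "\<And>k. closed_fun (fm k)"
    and "(\<lambda>k. dist (x (Suc k)) (x k)) \<longlonglongrightarrow> 0"
    and "\<And>k. fm k (x (Suc k)) \<le> (INF y. fm k y) + ereal (\<epsilon> k)"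
    and "\<epsilon> \<longlonglongrightarrow> 0"
    and "proper_growth_function \<omega>"
    and "\<And>k y. ext_close (fm k y) (f y) (\<omega> (dist y (x k)))"
    and "\<bar>f xstar\<bar> \<noteq> \<infinity>"
    and "\<exists>r. strict_mono r \<and> (\<lambda>j. (x (r j), f (x (r j)))) \<longlonglongrightarrow> (xstar, f xstar)"
  shows "stationary f xstar"
proof -
  obtain r where r: "strict_mono r"
    and pair: "(\<lambda>j. (x (r j), f (x (r j)))) \<longlonglongrightarrow> (xstar, f xstar)"
    using assms(12) by blast
  have xr: "(\<lambda>j. x (r j)) \<longlonglongrightarrow> xstar" and fr: "(\<lambda>j. f (x (r j))) \<longlonglongrightarrow> f xstar"
    using tendsto_fst[OF pair] tendsto_snd[OF pair] by simp_all
  have \<omega>_nonneg: "\<And>t. 0 \<le> t \<Longrightarrow> 0 \<le> \<omega> t" and \<omega>_cont: "continuous_on {0..} \<omega>" and \<omega>0: "\<omega> 0 = 0"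
    using assms(9) by (auto simp: proper_growth_function_def growth_function_def
        differentiable_imp_continuous_on)
  define d where "d j = dist (x (Suc (r j))) (x (r j))" for j
  define \<eta> where "\<eta> j = \<epsilon> (r j) + 2 * \<omega> (d j)" for j
  have d: "d \<longlonglongrightarrow> 0"
    using LIMSEQ_subseq_LIMSEQ[OF assms(6) r] by (simp add: d_def[abs_def] o_def)
  have "(\<lambda>j. \<omega> (d j)) \<longlonglongrightarrow> \<omega> 0"
    by (rule continuous_on_tendsto_compose[OF \<omega>_cont d]) (auto simp: d_def)
  then have \<eta>: "\<eta> \<longlonglongrightarrow> 0"
    using tendsto_add[OF LIMSEQ_subseq_LIMSEQ[OF assms(8) r] tendsto_mult_right_zero[of _ _ 2]]
    by (simp add: \<eta>_def[abs_def] o_def \<omega>0)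
  have min: "fm k (x (Suc k)) \<le> fm k y + ereal (\<epsilon> k)" for k y
    using assms(7)[of k] add_right_mono[OF INF_lower[of y UNIV "fm k"]] order_trans by blast
  have "limiting_slope f xstar \<le> ereal e" if e: "0 < e" for e
  proof -
    \<comment> \<open>Half of \<open>e\<close> is spent on the variation of \<open>\<omega>\<close>
      near 0, the other half on Ekeland's constant.\<close>
    obtain \<delta> where \<delta>: "0 < \<delta>" and Lip: "\<And>s t. 0 \<le> s \<Longrightarrow> s < \<delta> \<Longrightarrow> 0 \<le> t \<Longrightarrow> t < \<delta> \<Longrightarrow>
        \<omega> s - \<omega> t \<le> e / 2 * \<bar>s - t\<bar>"
      using proper_growth_function_local_Lipschitz[OF assms(9), of "e / 2"] e by auto
    have "\<exists>z. e / 2 * dist z (x (Suc (r j))) \<le> \<eta> j \<and> f z \<le> f (x (r j)) + ereal (\<eta> j) \<and>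
        (\<forall>y. f z + ereal (\<omega> (dist z (x (r j))))
          \<le> f y + ereal (\<omega> (dist y (x (r j))) + e / 2 * dist z y))" for j
      by (rule near_minimizer_of_model[where f = f and x = "x (r j)" and g = "fm (r j)"
            and p = "x (Suc (r j))" and \<omega> = \<omega> and \<epsilon> = "\<epsilon> (r j)" and \<kappa> = "e / 2" and \<eta> = "\<eta> j"])
        (use assms(1,2,10) assms(3)[of "r j"] \<omega>_nonneg \<omega>_cont \<omega>0 min e in \<open>auto simp: \<eta>_def d_def\<close>)
    then obtain z where z_near: "\<And>j. e / 2 * dist (z j) (x (Suc (r j))) \<le> \<eta> j"
      and z_val: "\<And>j. f (z j) \<le> f (x (r j)) + ereal (\<eta> j)"
      and z_min: "\<And>j y. f (z j) + ereal (\<omega> (dist (z j) (x (r j))))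
        \<le> f y + ereal (\<omega> (dist y (x (r j))) + e / 2 * dist (z j) y)"
      by metis
    \<comment> \<open>The factor \<open>2 / e\<close> comes from dividing \<open>z_near\<close> by
      \<open>e / 2\<close>; as \<open>e\<close> is fixed, the bound still tends to 0.\<close>
    have dist_z: "dist (z j) (x (r j)) \<le> 2 / e * \<eta> j + d j" for j
    proof -
      have "dist (z j) (x (Suc (r j))) \<le> 2 / e * \<eta> j" using z_near[of j] e by (simp add: field_simps)
      then show ?thesis unfolding d_def using dist_triangle by (smt (verit))
    qed
    have zx: "(\<lambda>j. dist (z j) (x (r j))) \<longlonglongrightarrow> 0"
    proof (rule tendsto_sandwich[where f = "\<lambda>_. 0"])
      show "(\<lambda>j. 2 / e * \<eta> j + d j) \<longlonglongrightarrow> 0"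
        using tendsto_add[OF tendsto_mult_right_zero[OF \<eta>, of "2 / e"] d] by simp
    qed (use dist_z in auto)
    have z: "z \<longlonglongrightarrow> xstar"
    proof (subst tendsto_dist_iff, rule tendsto_sandwich[where f = "\<lambda>_. 0"])
      show "(\<lambda>j. dist (z j) (x (r j)) + dist (x (r j)) xstar) \<longlonglongrightarrow> 0"
        using tendsto_add[OF zx iffD1[OF tendsto_dist_iff xr]] by simp
    qed (simp_all add: dist_triangle)
    have fz: "(\<lambda>j. f (z j)) \<longlonglongrightarrow> f xstar"
    proof (rule closed_fun_tendsto_of_upper_bound[OF assms(2) z])
      show "\<forall>\<^sub>F j in sequentially. f (z j) \<le> f (x (r j)) + ereal (\<eta> j)" using z_val by simp
      have "(\<lambda>j. f (x (r j)) + ereal (\<eta> j)) \<longlonglongrightarrow> f xstar + ereal 0"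
        using fr \<eta> assms(11) by (intro tendsto_add_ereal) auto
      then show "(\<lambda>j. f (x (r j)) + ereal (\<eta> j)) \<longlonglongrightarrow> f xstar" by (simp flip: zero_ereal_def)
    qed
    have "\<forall>\<^sub>F j in sequentially. dist (z j) (x (r j)) < \<delta>"
      using order_tendstoD(2)[OF zx \<delta>] .
    then have "\<forall>\<^sub>F j in sequentially. slope f (z j) \<le> ereal e"
    proof eventually_elim
      case (elim j)
      have "((\<lambda>y. dist y (x (r j))) \<longlongrightarrow> dist (z j) (x (r j))) (at (z j))"
        by (intro tendsto_intros)
      then have "\<forall>\<^sub>F y in at (z j). dist y (x (r j)) < \<delta>" using elim by (rule order_tendstoD(2))
      then have "\<forall>\<^sub>F y in at (z j). f (z j) \<le> f y + ereal (e * dist (z j) y)"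
      proof eventually_elim
        case (elim y)
        \<comment> \<open>Both distances to \<open>x (r j)\<close> lie below
          \<open>\<delta>\<close>, so removing \<open>\<omega>\<close> from \<open>z_min\<close>
          costs another \<open>e / 2\<close> times the distance, for a total of
          \<open>e\<close>.\<close>
        have "\<omega> (dist y (x (r j))) - \<omega> (dist (z j) (x (r j)))
            \<le> e / 2 * \<bar>dist y (x (r j)) - dist (z j) (x (r j))\<bar>"
          using Lip elim \<open>dist (z j) (x (r j)) < \<delta>\<close> by simp
        also have "\<dots> \<le> e / 2 * dist (z j) y"
          using e abs_dist_diff_le[of y "x (r j)" "z j"]
          by (intro mult_left_mono) (auto simp: dist_commute)
        finally show ?case
          using z_min[of j y] by (cases "f y"; cases "f (z j)") (auto simp: field_simps)
      qed
      moreover have "f (z j) \<noteq> \<infinity>"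
        using z_val[of j] assms(3)[of "r j"] by (cases "f (x (r j))") auto
      ultimately show ?case using slope_le[OF assms(1)] e by simp
    qed
    then show ?thesis by (rule limiting_slope_le[OF z fz])
  qed
  then have "limiting_slope f xstar \<le> 0"
    using ereal_le_epsilon2[of "limiting_slope f xstar" 0] by simp
  moreover have "0 \<le> limiting_slope f xstar"
    unfolding limiting_slope_def by (intro Liminf_bounded always_eventually allI slope_nonneg)
  ultimately show ?thesis using assms(11) by (simp add: stationary_def)
qed

end
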